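(* Let $u$ be a fuzzy set in $F^1_{USCG}(X)$ and let $u_n$, $n=1,2,\ldots$, be fuzzy sets in $F^1_{USC}(X)$. Then the following are equivalent: (i) $\lim_{n\to\infty}H_{\rm end}(u_n,u)=0$; (ii) for each $\alpha\in(0,1)$, $\lim_{n\to\infty}H^*(\overline{\{u>\alpha\}},[u_n]_\alpha)=0$ and $\lim_{n\to\infty}H^*([u_n]_\alpha,[u]_\alpha)=0$; (iii) there is a dense subset $P$ of $(0,1)$ such that for each $\alpha\in P$, $\lim_{n\to\infty}H^*(\overline{\{u>\alpha\}},[u_n]_\alpha)=0$ and $\lim_{n\to\infty}H^*([u_n]_\alpha,[u]_\alpha)=0$; (iv) for each $\alpha\in(0,1)\setminus P_0(u)$, $\lim_{n\to\infty}H([u]_\alpha,[u_n]_\alpha)=0$; (v) there is a dense subset $P$ of $(0,1)\setminus P_0(u)$ such that for each $\alpha\in P$, $\lim_{n\to\infty}H([u]_\alpha,[u_n]_\alpha)=0$; (vi) there is a countable dense subset $P$ of $(0,1)\setminus P_0(u)$ such that for each $\alpha\in P$, $\lim_{n\to\infty}H([u]_\alpha,[u_n]_\alpha)=0$; (vii) $H([u_n]_\alpha,[u]_\alpha)\to0$ holds a.e. on $\alpha\in(0,1)$.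
   Context: $(X,d)$ is a nonempty metric space. $X\times[0,1]$ carries the metric $\overline d((x,\alpha),(y,\beta))=d(x,y)+|\alpha-\beta|$. A fuzzy set in $X$ is a function $u:X\to[0,1]$, with $\{u>\alpha\}=\{x\in X:u(x)>\alpha\}$, and $\alpha$-cuts $[u]_\alpha=\{x\in X: u(x)\ge\alpha\}$ for $\alpha\in(0,1]$ and $[u]_0=\overline{\{u>0\}}$ (overline is closure in $X$). $F^1_{USC}(X)$ is the set of fuzzy sets $u$ in $X$ such that $[u]_\alpha$ is nonempty and closed for all $\alpha\in[0,1]$; $F^1_{USCG}(X)$ is the set of $u\in F^1_{USC}(X)$ with $[u]_\alpha$ compact for all $\alpha\in(0,1]$. For nonempty closed sets $A,B$, $H^*(A,B)=\sup_{a\in A}\inf_{b\in B}\rho(a,b)\in[0,+\infty]$ and $H(A,B)=\max\{H^*(A,B),H^*(B,A)\}$, with $\rho=d$ on $X$ and $\rho=\overline d$ on $X\times[0,1]$. With ${\rm end}\,u=\{(x,t)\in X\times[0,1]:u(x)\ge t\}$, $H_{\rm end}(u,v)=H({\rm end}\,u,{\rm end}\,v)$. $P_0(u)=(0,1)\setminus\{\alpha\in(0,1):\lim_{\beta\to\alpha}H([u]_\beta,[u]_\alpha)=0\}$. "a.e." is with respect to Lebesgue measure. "Countable" means finite or countably infinite. *)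

theory Defs
  imports "HOL-Analysis.Analysis"
begin

(* ennreal-valued, so that the value \<infinity> is attained for sets at infinite excess; only meant for
   nonempty A and B. *)
definition Hausdorff_excess :: "('a \<Rightarrow> 'a \<Rightarrow> real) \<Rightarrow> 'a set \<Rightarrow> 'a set \<Rightarrow> ennreal" where
  "Hausdorff_excess \<rho> A B = (SUP a\<in>A. INF b\<in>B. ennreal (\<rho> a b))"

definition Hausdorff_distance :: "('a \<Rightarrow> 'a \<Rightarrow> real) \<Rightarrow> 'a set \<Rightarrow> 'a set \<Rightarrow> ennreal" where
  "Hausdorff_distance \<rho> A B = max (Hausdorff_excess \<rho> A B) (Hausdorff_excess \<rho> B A)"

(* The sum metric on X \<times> [0,1]; the library's dist on pairs is the Euclidean product metric. *)
definition sum_dist :: "'a::metric_space \<times> real \<Rightarrow> 'a \<times> real \<Rightarrow> real" where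
  "sum_dist p q = dist (fst p) (fst q) + \<bar>snd p - snd q\<bar>"

definition fuzzy_sets :: "('a \<Rightarrow> real) set" where
  "fuzzy_sets = {u. \<forall>x. u x \<in> {0..1}}"

(* Only meant for \<alpha> \<in> [0,1]; off that interval the value is junk. *)
definition alpha_cut :: "('a::metric_space \<Rightarrow> real) \<Rightarrow> real \<Rightarrow> 'a set" where
  "alpha_cut u \<alpha> = (if \<alpha> = 0 then closure {x. u x > 0} else {x. u x \<ge> \<alpha>})"

definition F1_USC :: "('a::metric_space \<Rightarrow> real) set" where
  "F1_USC = {u \<in> fuzzy_sets. \<forall>\<alpha>\<in>{0..1}. alpha_cut u \<alpha> \<noteq> {} \<and> closed (alpha_cut u \<alpha>)}"

definition F1_USCG :: "('a::metric_space \<Rightarrow> real) set" where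
  "F1_USCG = {u \<in> F1_USC. \<forall>\<alpha>\<in>{0<..1}. compact (alpha_cut u \<alpha>)}"

definition endograph :: "('a \<Rightarrow> real) \<Rightarrow> ('a \<times> real) set" where
  "endograph u = {(x, t). t \<in> {0..1} \<and> u x \<ge> t}"

definition H_end :: "('a::metric_space \<Rightarrow> real) \<Rightarrow> ('a \<Rightarrow> real) \<Rightarrow> ennreal" where
  "H_end u v = Hausdorff_distance sum_dist (endograph u) (endograph v)"

definition P0 :: "('a::metric_space \<Rightarrow> real) \<Rightarrow> real set" where
  "P0 u = {0<..<1} - {\<alpha> \<in> {0<..<1}.
     ((\<lambda>\<beta>. Hausdorff_distance dist (alpha_cut u \<beta>) (alpha_cut u \<alpha>)) \<longlongrightarrow> 0) (at \<alpha> within {0..1})}"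

(* Density in the subspace topology of S: S \<inter> closure P is the closure of P in S. *)
definition dense_subset :: "'a::topological_space set \<Rightarrow> 'a set \<Rightarrow> bool" where
  "dense_subset P S \<longleftrightarrow> P \<subseteq> S \<and> S \<subseteq> closure P"

end

theory Submission
  imports Defs
begin

text \<open>
  The sum metric on endographs sees a horizontal error (in \<open>X\<close>) and a vertical error (in the level)
  at the same time, whereas the conditions on cuts compare sets at one fixed level. The bridge
  between the two is that \<open>u\<close> has compact cuts at positive levels, so a sufficiently small vertical
  error can be traded for a small horizontal one. Lowering the level slightly below \<open>\<alpha>\<close> enlarges
  the cut only by a small neighbourhood of the cut at \<open>\<alpha>\<close>
  (\<open>cuts_approximated_from_below\<close>); raising it slightly above \<open>\<alpha>\<close> still leaves a set that comes
  close to every point of the closure of \<open>{u > \<alpha>}\<close> (\<open>cuts_approximated_from_above\<close>). Points of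
  the cut outside that closure may be lost, which is why the two one-sided conditions use two
  different cuts of \<open>u\<close>.

  Endograph convergence therefore yields the two one-sided conditions at every level
  (\<open>cuts_converge_if_H_end\<close>). Conversely, finitely many levels of a dense set come from below
  within a given distance of every level that is not close to \<open>0\<close>, and points at low levels are
  within a small vertical distance of the base of the other endograph; hence convergence at the levels of a dense set
  suffices (\<open>H_end_if_cuts_converge\<close>).

  The two approximation lemmas also show that the cut function of \<open>u\<close> is continuous at \<open>\<alpha>\<close>
  precisely if the cut at \<open>\<alpha>\<close> is the closure of \<open>{u > \<alpha>}\<close>. At such levels the two one-sided
  conditions together are Hausdorff convergence. If the equality fails, \<open>\<alpha>\<close> is the value of \<open>u\<close> at
  a local maximum; the set \<open>{u > 0}\<close> is a countable union of compact sets, and a function has only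
  countably many local maximum values on such a set (\<open>countable_P0\<close>). So the exceptional levels form
  a null set whose complement is dense. As a property that holds almost everywhere on the unit
  interval holds on a dense set, all the remaining conditions reduce to the ones on dense sets.
\<close>

section \<open>Vanishing Hausdorff excess\<close>

lemma Hausdorff_excess_le:
  assumes "\<And>a. a \<in> A \<Longrightarrow> \<exists>b\<in>B. \<rho> a b < e"
  shows "Hausdorff_excess \<rho> A B \<le> ennreal e"
  unfolding Hausdorff_excess_def
proof (rule SUP_least)
  fix a assume "a \<in> A"
  with assms obtain b where "b \<in> B" "\<rho> a b < e" by blast
  then show "(INF b\<in>B. ennreal (\<rho> a b)) \<le> ennreal e"
    by (meson INF_lower2 ennreal_leI less_imp_le)
qed

lemma Hausdorff_excess_less_imp:
  assumes "Hausdorff_excess \<rho> A B < ennreal e" and "a \<in> A"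
  shows "\<exists>b\<in>B. \<rho> a b < e"
proof -
  have "(INF b\<in>B. ennreal (\<rho> a b)) < ennreal e"
    using assms unfolding Hausdorff_excess_def by (meson SUP_upper le_less_trans)
  then obtain b where "b \<in> B" "ennreal (\<rho> a b) < ennreal e"
    by (auto simp: INF_less_iff)
  then show ?thesis
    by (meson ennreal_leI leD not_le)
qed

lemma Hausdorff_excess_mono_left:
  "A \<subseteq> A' \<Longrightarrow> Hausdorff_excess \<rho> A B \<le> Hausdorff_excess \<rho> A' B"
  unfolding Hausdorff_excess_def by (rule SUP_subset_mono) auto

text \<open>
  Replaces the extended suprema and infima by neighbourhoods of the sets. It holds along arbitrary
  filters because it serves both the limit in \<open>n\<close> and the limit in the level that defines \<open>P0\<close>.
\<close>

lemma tendsto_Hausdorff_excess_0_iff: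
  "((\<lambda>i. Hausdorff_excess \<rho> (A i) (B i)) \<longlongrightarrow> 0) F \<longleftrightarrow>
     (\<forall>e>0. \<forall>\<^sub>F i in F. \<forall>a\<in>A i. \<exists>b\<in>B i. \<rho> a b < e)"
proof
  assume lim: "((\<lambda>i. Hausdorff_excess \<rho> (A i) (B i)) \<longlongrightarrow> 0) F"
  show "\<forall>e>0. \<forall>\<^sub>F i in F. \<forall>a\<in>A i. \<exists>b\<in>B i. \<rho> a b < e"
  proof (intro allI impI)
    fix e :: real assume "e > 0"
    then have "\<forall>\<^sub>F i in F. Hausdorff_excess \<rho> (A i) (B i) < ennreal e"
      using lim by (intro order_tendstoD(2)) auto
    then show "\<forall>\<^sub>F i in F. \<forall>a\<in>A i. \<exists>b\<in>B i. \<rho> a b < e"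
      by eventually_elim (blast intro: Hausdorff_excess_less_imp)
  qed
next
  assume ev: "\<forall>e>0. \<forall>\<^sub>F i in F. \<forall>a\<in>A i. \<exists>b\<in>B i. \<rho> a b < e"
  show "((\<lambda>i. Hausdorff_excess \<rho> (A i) (B i)) \<longlongrightarrow> 0) F"
  proof (rule order_tendstoI)
    fix y :: ennreal assume "0 < y"
    then obtain z where z: "0 < z" "z < y" using dense by blast
    then obtain e where "z = ennreal e" by (cases z) auto
    with z have e: "0 < e" "ennreal e < y" by auto
    with ev have "\<forall>\<^sub>F i in F. \<forall>a\<in>A i. \<exists>b\<in>B i. \<rho> a b < e" by blast
    then show "\<forall>\<^sub>F i in F. Hausdorff_excess \<rho> (A i) (B i) < y"
    proof eventually_elim
      case (elim i)
      then have "Hausdorff_excess \<rho> (A i) (B i) \<le> ennreal e"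
        by (intro Hausdorff_excess_le) simp
      then show ?case using e(2) by (rule le_less_trans)
    qed
  qed simp
qed

lemma Hausdorff_distance_commute:
  "Hausdorff_distance \<rho> A B = Hausdorff_distance \<rho> B A"
  by (simp add: Hausdorff_distance_def max.commute)

lemma tendsto_Hausdorff_distance_0_iff:
  "((\<lambda>i. Hausdorff_distance \<rho> (A i) (B i)) \<longlongrightarrow> 0) F \<longleftrightarrow>
     ((\<lambda>i. Hausdorff_excess \<rho> (A i) (B i)) \<longlongrightarrow> 0) F \<and>
     ((\<lambda>i. Hausdorff_excess \<rho> (B i) (A i)) \<longlongrightarrow> 0) F"
  unfolding order_tendsto_iff Hausdorff_distance_def
  by (auto simp: eventually_conj_iff)

section \<open>Approximating the cuts of a fuzzy set with compact cuts\<close>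

lemma alpha_cut_nonzero: "\<alpha> \<noteq> 0 \<Longrightarrow> alpha_cut u \<alpha> = {x. \<alpha> \<le> u x}"
  by (simp add: alpha_cut_def)

lemma F1_USCG_compact_cut:
  "u \<in> F1_USCG \<Longrightarrow> 0 < \<alpha> \<Longrightarrow> \<alpha> \<le> 1 \<Longrightarrow> compact {x. \<alpha> \<le> u x}"
  unfolding F1_USCG_def alpha_cut_def by (auto dest: bspec[of _ _ \<alpha>])

lemma fuzzy_set_bounds:
  assumes "u \<in> F1_USC" shows "0 \<le> u x" "u x \<le> 1"
  using assms by (auto simp: F1_USC_def fuzzy_sets_def)

lemma F1_USCG_imp_F1_USC: "u \<in> F1_USCG \<Longrightarrow> u \<in> F1_USC"
  by (simp add: F1_USCG_def)

lemma closure_strict_cut_subset: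
  assumes "u \<in> F1_USCG" "0 < \<alpha>" "\<alpha> < 1"
  shows "closure {x. \<alpha> < u x} \<subseteq> {x. \<alpha> \<le> u x}"
  using F1_USCG_compact_cut[of u \<alpha>] assms
  by (intro closure_minimal) (auto intro: compact_imp_closed)

text \<open>
  The cuts at levels below \<open>\<alpha>\<close> shrink to the cut at \<open>\<alpha>\<close>, and they are compact; hence they
  eventually enter each neighbourhood of it. The proof covers the cut at \<open>\<alpha>/2\<close> by this
  neighbourhood together with the complements of the cuts at levels between \<open>\<alpha>/2\<close> and \<open>\<alpha>\<close>.
\<close>

lemma cuts_approximated_from_below:
  fixes u :: "'a::metric_space \<Rightarrow> real"
  assumes u: "u \<in> F1_USCG" and \<alpha>: "0 < \<alpha>" "\<alpha> < 1" and e: "0 < e"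
  obtains \<gamma> where "0 < \<gamma>" "\<gamma> < \<alpha>" "\<And>y. \<gamma> < u y \<Longrightarrow> \<exists>z. \<alpha> \<le> u z \<and> dist y z < e"
proof -
  define U where "U = (\<Union>z\<in>{z. \<alpha> \<le> u z}. ball z e)"
  define W where "W \<beta> = U \<union> - {x. \<beta> \<le> u x}" for \<beta>
  have "open (W \<beta>)" if "\<beta> \<in> {\<alpha>/2<..<\<alpha>}" for \<beta>
    unfolding W_def U_def using that \<alpha> F1_USCG_compact_cut[OF u, of \<beta>]
    by (intro open_Un open_UN ballI open_ball open_Compl compact_imp_closed) auto
  moreover have "{x. \<alpha>/2 \<le> u x} \<subseteq> (\<Union>\<beta>\<in>{\<alpha>/2<..<\<alpha>}. W \<beta>)"
  proof
    fix x assume x: "x \<in> {x. \<alpha>/2 \<le> u x}"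
    show "x \<in> (\<Union>\<beta>\<in>{\<alpha>/2<..<\<alpha>}. W \<beta>)"
    proof (cases "\<alpha> \<le> u x")
      case True
      then have "x \<in> U" using e by (auto simp: U_def)
      then show ?thesis using \<alpha> by (auto simp: W_def intro!: bexI[of _ "3*\<alpha>/4"])
    next
      case False
      then obtain \<beta> where "u x < \<beta>" "\<beta> < \<alpha>" using dense[of "u x" \<alpha>] by auto
      then show ?thesis using x by (auto simp: W_def intro!: bexI[of _ \<beta>])
    qed
  qed
  moreover have "compact {x. \<alpha>/2 \<le> u x}"
    using \<alpha> by (intro F1_USCG_compact_cut[OF u]) auto
  ultimately obtain B where B: "B \<subseteq> {\<alpha>/2<..<\<alpha>}" "finite B" "{x. \<alpha>/2 \<le> u x} \<subseteq> (\<Union>\<beta>\<in>B. W \<beta>)"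
    using compactE_image[of "{x. \<alpha>/2 \<le> u x}" "{\<alpha>/2<..<\<alpha>}" W] by blast
  define \<gamma> where "\<gamma> = Max (insert (\<alpha>/2) B)"
  have \<gamma>: "\<alpha>/2 \<le> \<gamma>" "\<And>\<beta>. \<beta> \<in> B \<Longrightarrow> \<beta> \<le> \<gamma>" using B(2) unfolding \<gamma>_def
    by (auto simp only: finite_insert insert_iff intro!: Max_ge)
  show thesis
  proof
    show "0 < \<gamma>" using \<gamma> \<alpha> by simp
    show "\<gamma> < \<alpha>" using B \<alpha> by (auto simp: \<gamma>_def)
    fix y assume y: "\<gamma> < u y"
    then have "y \<in> {x. \<alpha>/2 \<le> u x}" using \<gamma> by simp
    then obtain \<beta> where "\<beta> \<in> B" "y \<in> W \<beta>" using B by blast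
    then have "y \<in> U" using \<gamma> y unfolding W_def by force
    then show "\<exists>z. \<alpha> \<le> u z \<and> dist y z < e" by (auto simp: U_def dist_commute)
  qed
qed

text \<open>
  The compact closure of \<open>{u > \<alpha>}\<close> has a finite net of points in \<open>{u > \<alpha>}\<close> itself, and the
  smallest value of \<open>u\<close> on this net is still greater than \<open>\<alpha>\<close>.
\<close>

lemma cuts_approximated_from_above:
  fixes u :: "'a::metric_space \<Rightarrow> real"
  assumes u: "u \<in> F1_USCG" and \<alpha>: "0 < \<alpha>" "\<alpha> < 1" and e: "0 < e"
  obtains \<gamma> where "\<alpha> < \<gamma>" "\<And>x. x \<in> closure {x. \<alpha> < u x} \<Longrightarrow> \<exists>p. \<gamma> \<le> u p \<and> dist x p < e"
proof -
  let ?S = "{x. \<alpha> < u x}"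
  have "compact {x. \<alpha> \<le> u x}" using F1_USCG_compact_cut[OF u] \<alpha> by simp
  then have "compact (closure ?S)"
    using closure_strict_cut_subset[OF u \<alpha>]
    by (metis closed_closure compact_Int_closed inf.absorb2)
  moreover have "closure ?S \<subseteq> (\<Union>p\<in>?S. ball p e)"
    using e by (fastforce simp: closure_approachable)
  ultimately obtain F where F: "F \<subseteq> ?S" "finite F" "closure ?S \<subseteq> (\<Union>p\<in>F. ball p e)"
    using compactE_image[of "closure ?S" ?S "\<lambda>p. ball p e"] by blast
  \<comment> \<open>The \<open>1\<close> only makes the minimum meaningful for an empty net.\<close>
  define \<gamma> where "\<gamma> = Min (insert 1 (u ` F))"
  show thesis
  proof
    show "\<alpha> < \<gamma>" using F \<alpha> by (auto simp: \<gamma>_def)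
    fix x assume "x \<in> closure ?S"
    then obtain p where "p \<in> F" "dist p x < e" using F by auto
    moreover have "\<gamma> \<le> u p" using \<open>p \<in> F\<close> F by (auto simp: \<gamma>_def)
    ultimately show "\<exists>p. \<gamma> \<le> u p \<and> dist x p < e" by (auto simp: dist_commute)
  qed
qed

section \<open>Discontinuity levels\<close>

text \<open>
  Continuity from the right suffices: the points of a cut at a level just above \<open>\<alpha>\<close> lie in
  \<open>{u > \<alpha>}\<close>.
\<close>

lemma cut_eq_closure_if_not_P0:
  fixes u :: "'a::metric_space \<Rightarrow> real"
  assumes u: "u \<in> F1_USCG" and \<alpha>: "\<alpha> \<in> {0<..<1} - P0 u"
  shows "closure {x. \<alpha> < u x} = alpha_cut u \<alpha>"
proof
  have \<alpha>': "0 < \<alpha>" "\<alpha> < 1" using \<alpha> by auto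
  then show "closure {x. \<alpha> < u x} \<subseteq> alpha_cut u \<alpha>"
    using closure_strict_cut_subset[OF u] by (simp add: alpha_cut_nonzero)
  have lim: "((\<lambda>\<beta>. Hausdorff_excess dist (alpha_cut u \<alpha>) (alpha_cut u \<beta>)) \<longlongrightarrow> 0)
      (at \<alpha> within {0..1})"
    using \<alpha> by (auto simp: P0_def tendsto_Hausdorff_distance_0_iff)
  show "alpha_cut u \<alpha> \<subseteq> closure {x. \<alpha> < u x}"
  proof
    fix x assume x: "x \<in> alpha_cut u \<alpha>"
    show "x \<in> closure {x. \<alpha> < u x}"
      unfolding closure_approachable
    proof (intro allI impI)
      fix e :: real assume "0 < e"
      then have "\<forall>\<^sub>F \<beta> in at \<alpha> within {0..1}.
          \<forall>a\<in>alpha_cut u \<alpha>. \<exists>b\<in>alpha_cut u \<beta>. dist a b < e"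
        using lim unfolding tendsto_Hausdorff_excess_0_iff by blast
      then obtain d where d: "d > 0" "\<And>\<beta>. \<beta> \<in> {0..1} \<Longrightarrow> \<beta> \<noteq> \<alpha> \<Longrightarrow> dist \<beta> \<alpha> < d \<Longrightarrow>
          \<forall>a\<in>alpha_cut u \<alpha>. \<exists>b\<in>alpha_cut u \<beta>. dist a b < e"
        unfolding eventually_at by blast
      define \<beta> where "\<beta> = min 1 (\<alpha> + d/2)"
      have \<beta>: "\<alpha> < \<beta>" "\<beta> \<in> {0..1}" "dist \<beta> \<alpha> < d"
        using \<alpha>' d by (auto simp: \<beta>_def dist_real_def min_def)
      then obtain b where "b \<in> alpha_cut u \<beta>" "dist x b < e" using d x by blast
      then show "\<exists>y\<in>{x. \<alpha> < u x}. dist y x < e"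
        using \<beta> \<alpha>' by (intro bexI[of _ b]) (auto simp: alpha_cut_nonzero dist_commute)
    qed
  qed
qed

lemma not_P0_if_cut_subset_closure:
  fixes u :: "'a::metric_space \<Rightarrow> real"
  assumes u: "u \<in> F1_USCG" and \<alpha>: "0 < \<alpha>" "\<alpha> < 1"
    and sub: "{x. \<alpha> \<le> u x} \<subseteq> closure {x. \<alpha> < u x}"
  shows "\<alpha> \<notin> P0 u"
proof -
  have close: "\<forall>\<^sub>F \<beta> in at \<alpha> within {0..1}.
      (\<forall>a\<in>alpha_cut u \<beta>. \<exists>b\<in>alpha_cut u \<alpha>. dist a b < e) \<and>
      (\<forall>a\<in>alpha_cut u \<alpha>. \<exists>b\<in>alpha_cut u \<beta>. dist a b < e)" if e: "e > 0" for e
  proof -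
    obtain \<gamma> where \<gamma>: "0 < \<gamma>" "\<gamma> < \<alpha>" "\<And>y. \<gamma> < u y \<Longrightarrow> \<exists>z. \<alpha> \<le> u z \<and> dist y z < e"
      using cuts_approximated_from_below[OF u \<alpha> e] by metis
    obtain \<delta> where \<delta>: "\<alpha> < \<delta>"
      "\<And>x. x \<in> closure {x. \<alpha> < u x} \<Longrightarrow> \<exists>p. \<delta> \<le> u p \<and> dist x p < e"
      using cuts_approximated_from_above[OF u \<alpha> e] by metis
    have "\<forall>\<^sub>F \<beta> in at \<alpha> within {0..1}. \<gamma> < \<beta> \<and> \<beta> < \<delta>"
      using order_tendstoD(1)[OF tendsto_ident_at \<gamma>(2)] order_tendstoD(2)[OF tendsto_ident_at \<delta>(1)]
      by (rule eventually_conj)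
    then show ?thesis
    proof eventually_elim
      case (elim \<beta>)
      have 1: "\<exists>b\<in>{x. \<alpha> \<le> u x}. dist a b < e" if "\<beta> \<le> u a" for a
        using \<gamma>(3)[of a] that elim(1) by simp
      have 2: "\<exists>b\<in>{x. \<beta> \<le> u x}. dist a b < e" if "\<alpha> \<le> u a" for a
      proof -
        have "a \<in> closure {x. \<alpha> < u x}" using sub that by blast
        then obtain p where "\<delta> \<le> u p" "dist a p < e" using \<delta>(2) by blast
        then show ?thesis using elim by (intro bexI[of _ p]) auto
      qed
      have "alpha_cut u \<alpha> = {x. \<alpha> \<le> u x}" "alpha_cut u \<beta> = {x. \<beta> \<le> u x}"
        using elim \<gamma>(1) \<alpha> by (auto simp: alpha_cut_nonzero)
      then show ?case using 1 2 by simp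
    qed
  qed
  have "((\<lambda>\<beta>. Hausdorff_distance dist (alpha_cut u \<beta>) (alpha_cut u \<alpha>)) \<longlongrightarrow> 0)
      (at \<alpha> within {0..1})"
    unfolding tendsto_Hausdorff_distance_0_iff tendsto_Hausdorff_excess_0_iff
    using close unfolding eventually_conj_iff by blast
  then show ?thesis unfolding P0_def by blast
qed

text \<open>
  A discontinuity level \<open>\<alpha>\<close> is the value of \<open>u\<close> at a local maximum \<open>x\<close>. For each \<open>m\<close> and \<open>k\<close> the
  compact cut at \<open>r m\<close> has a finite net with balls of radius \<open>r k\<close>, and \<open>\<alpha>\<close> is the supremum of \<open>u\<close>
  over one of these balls: if \<open>r m < \<alpha>\<close> and \<open>r k\<close> is small, a ball that contains \<open>x\<close> stays in the
  neighbourhood where \<open>u\<close> is at most \<open>\<alpha>\<close>. There are only countably many such balls.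
\<close>

lemma countable_P0:
  fixes u :: "'a::metric_space \<Rightarrow> real"
  assumes u: "u \<in> F1_USCG"
  shows "countable (P0 u)"
proof -
  define r where "r k = inverse (real (Suc k))" for k
  have r: "0 < r k" "r k \<le> 1" for k by (auto simp: r_def divide_simps)
  have small: "\<exists>k. r k < e" if "e > 0" for e
    using reals_Archimedean[OF that] by (simp add: r_def)
  have net: "\<exists>F. finite F \<and> {x. r m \<le> u x} \<subseteq> (\<Union>c\<in>F. ball c (r k))" for m k
  proof -
    have cpt: "compact {x. r m \<le> u x}" using F1_USCG_compact_cut[OF u] r by blast
    have cover: "{x. r m \<le> u x} \<subseteq> (\<Union>c\<in>UNIV. ball c (r k))"
    proof
      fix x show "x \<in> (\<Union>c\<in>UNIV. ball c (r k))"
        using r(1) by (intro UN_I[of x]) simp_all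
    qed
    show ?thesis by (rule compactE_image[OF cpt open_ball cover]) (intro exI conjI)
  qed
  define F where "F m k = (SOME F. finite F \<and> {x. r m \<le> u x} \<subseteq> (\<Union>c\<in>F. ball c (r k)))" for m k
  have F: "finite (F m k)" "{x. r m \<le> u x} \<subseteq> (\<Union>c\<in>F m k. ball c (r k))" for m k
    using someI_ex[OF net[of m k]] unfolding F_def by simp_all
  have "P0 u \<subseteq> (\<Union>m k. (\<lambda>c. SUP y\<in>ball c (r k). u y) ` F m k)"
  proof
    fix \<alpha> assume \<alpha>: "\<alpha> \<in> P0 u"
    then have \<alpha>': "0 < \<alpha>" "\<alpha> < 1" by (auto simp: P0_def)
    then obtain x where x: "\<alpha> \<le> u x" "x \<notin> closure {x. \<alpha> < u x}"
      using not_P0_if_cut_subset_closure[OF u] \<alpha> by blast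
    then obtain e where e: "e > 0" "\<And>y. dist y x < e \<Longrightarrow> u y \<le> \<alpha>"
      unfolding closure_approachable by force
    have ux: "u x = \<alpha>" using x e by (simp add: antisym)
    obtain m where m: "r m < \<alpha>" using small \<alpha>' by blast
    obtain k where k: "r k < e/2" using small[of "e/2"] e by auto
    have "x \<in> {x. r m \<le> u x}" using m ux by simp
    then obtain c where c: "c \<in> F m k" "dist c x < r k" using F(2)[of m k] by auto
    have "u y \<le> \<alpha>" if "y \<in> ball c (r k)" for y
    proof (rule e)
      have "dist y x \<le> dist y c + dist c x" by (rule dist_triangle)
      also have "\<dots> < e" using that c k by (simp add: dist_commute)
      finally show "dist y x < e" .
    qed
    then have "(SUP y\<in>ball c (r k). u y) = \<alpha>"
      using c ux by (intro cSup_eq_maximum) auto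
    then show "\<alpha> \<in> (\<Union>m k. (\<lambda>c. SUP y\<in>ball c (r k). u y) ` F m k)"
      using c by blast
  qed
  moreover have "countable (\<Union>m k. (\<lambda>c. SUP y\<in>ball c (r k). u y) ` F m k)"
    using F(1) by (intro countable_UN countable_image) (auto intro: countable_finite)
  ultimately show ?thesis by (rule countable_subset)
qed

section \<open>Endograph convergence and convergence of cuts\<close>

text \<open>
  A point of one endograph near a point at height \<open>t\<close> of the other can lie at a slightly different
  height. For the first limit the point is therefore first moved up to a height \<open>\<gamma> > \<alpha>\<close>, so that
  its companion stays above \<open>\<alpha>\<close>; for the second limit the companion, which may drop to some
  height above \<open>\<gamma> < \<alpha>\<close>, is moved back into the cut at \<open>\<alpha>\<close>.
\<close>

lemma cuts_converge_if_H_end: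
  fixes u :: "'a::metric_space \<Rightarrow> real"
  assumes u: "u \<in> F1_USCG" and lim: "(\<lambda>n. H_end (un n) u) \<longlonglongrightarrow> 0"
    and \<alpha>: "0 < \<alpha>" "\<alpha> < 1"
  shows "(\<lambda>n. Hausdorff_excess dist (closure {x. u x > \<alpha>}) (alpha_cut (un n) \<alpha>)) \<longlonglongrightarrow> 0"
    and "(\<lambda>n. Hausdorff_excess dist (alpha_cut (un n) \<alpha>) (alpha_cut u \<alpha>)) \<longlonglongrightarrow> 0"
proof -
  have lim1: "\<forall>\<^sub>F n in sequentially. \<forall>p\<in>endograph (un n). \<exists>q\<in>endograph u. sum_dist p q < e"
    and lim2: "\<forall>\<^sub>F n in sequentially. \<forall>p\<in>endograph u. \<exists>q\<in>endograph (un n). sum_dist p q < e"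
    if "e > 0" for e
    using lim that
    unfolding H_end_def tendsto_Hausdorff_distance_0_iff tendsto_Hausdorff_excess_0_iff by blast+
  show "(\<lambda>n. Hausdorff_excess dist (closure {x. u x > \<alpha>}) (alpha_cut (un n) \<alpha>)) \<longlonglongrightarrow> 0"
    unfolding tendsto_Hausdorff_excess_0_iff
  proof (intro allI impI)
    fix e :: real assume e: "0 < e"
    then have "0 < e/2" by simp
    then obtain \<gamma> where \<gamma>: "\<alpha> < \<gamma>"
      "\<And>x. x \<in> closure {x. \<alpha> < u x} \<Longrightarrow> \<exists>p. \<gamma> \<le> u p \<and> dist x p < e/2"
      using cuts_approximated_from_above[OF u \<alpha>] by metis
    have "0 < min (e/2) (\<gamma> - \<alpha>)" using e \<gamma> by simp
    from lim2[OF this]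
    show "\<forall>\<^sub>F n in sequentially.
      \<forall>a\<in>closure {x. \<alpha> < u x}. \<exists>b\<in>alpha_cut (un n) \<alpha>. dist a b < e"
    proof eventually_elim
      case (elim n)
      show ?case
      proof
        fix x assume "x \<in> closure {x. \<alpha> < u x}"
        then obtain p where p: "\<gamma> \<le> u p" "dist x p < e/2" using \<gamma> by blast
        have "(p, u p) \<in> endograph u"
          using fuzzy_set_bounds[OF F1_USCG_imp_F1_USC[OF u]] by (simp add: endograph_def)
        with elim obtain y s where y: "s \<le> un n y" "dist p y + \<bar>u p - s\<bar> < min (e/2) (\<gamma> - \<alpha>)"
          by (fastforce simp: endograph_def sum_dist_def)
        have "dist p y < e/2" "\<alpha> \<le> un n y" using y p zero_le_dist[of p y] by linarith+
        then show "\<exists>b\<in>alpha_cut (un n) \<alpha>. dist x b < e"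
          using p(2) dist_triangle[of x y p] \<alpha> by (intro bexI[of _ y]) (auto simp: alpha_cut_nonzero)
      qed
    qed
  qed
  show "(\<lambda>n. Hausdorff_excess dist (alpha_cut (un n) \<alpha>) (alpha_cut u \<alpha>)) \<longlonglongrightarrow> 0"
    unfolding tendsto_Hausdorff_excess_0_iff
  proof (intro allI impI)
    fix e :: real assume e: "0 < e"
    then have "0 < e/2" by simp
    then obtain \<gamma> where \<gamma>: "0 < \<gamma>" "\<gamma> < \<alpha>"
      "\<And>y. \<gamma> < u y \<Longrightarrow> \<exists>z. \<alpha> \<le> u z \<and> dist y z < e/2"
      using cuts_approximated_from_below[OF u \<alpha>] by metis
    have "0 < min (e/2) (\<alpha> - \<gamma>)" using e \<gamma> by simp
    from lim1[OF this]
    show "\<forall>\<^sub>F n in sequentially. \<forall>a\<in>alpha_cut (un n) \<alpha>. \<exists>b\<in>alpha_cut u \<alpha>. dist a b < e"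
    proof eventually_elim
      case (elim n)
      show ?case
      proof
        fix x assume "x \<in> alpha_cut (un n) \<alpha>"
        then have "(x, \<alpha>) \<in> endograph (un n)" using \<alpha> by (simp add: endograph_def alpha_cut_nonzero)
        with elim obtain y s where y: "s \<le> u y" "dist x y + \<bar>\<alpha> - s\<bar> < min (e/2) (\<alpha> - \<gamma>)"
          by (fastforce simp: endograph_def sum_dist_def)
        have xy: "dist x y < e/2" "\<gamma> < u y" using y zero_le_dist[of x y] by linarith+
        then obtain z where "\<alpha> \<le> u z" "dist y z < e/2" using \<gamma> by blast
        then show "\<exists>b\<in>alpha_cut u \<alpha>. dist x b < e"
          using xy dist_triangle[of x z y] \<alpha> by (intro bexI[of _ z]) (auto simp: alpha_cut_nonzero)
      qed
    qed
  qed
qed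

text \<open>
  Finiteness makes the convergence at the selected levels uniform. The levels are strictly below
  \<open>t\<close>, since membership in \<open>{u > \<alpha>}\<close> is needed to apply the hypothesis on its closure.
\<close>

lemma finite_levels_just_below:
  fixes P :: "real set"
  assumes P: "dense_subset P {0<..<1}" and e: "0 < e"
  obtains F where "finite F" "F \<subseteq> P" "\<And>t. e \<le> t \<Longrightarrow> t \<le> 1 \<Longrightarrow> \<exists>\<alpha>\<in>F. \<alpha> < t \<and> t < \<alpha> + e"
proof -
  have "{e..1} \<subseteq> (\<Union>\<alpha>\<in>P. {\<alpha><..<\<alpha> + e})"
  proof
    fix t assume t: "t \<in> {e..1}"
    then have "t - e/2 \<in> closure P" using P e by (auto simp: dense_subset_def)
    then obtain \<alpha> where "\<alpha> \<in> P" "dist \<alpha> (t - e/2) < e/2"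
      unfolding closure_approachable using e by (meson half_gt_zero)
    then show "t \<in> (\<Union>\<alpha>\<in>P. {\<alpha><..<\<alpha> + e})"
      by (intro UN_I[of \<alpha>]) (auto simp: dist_real_def abs_less_iff field_simps)
  qed
  then obtain F where "F \<subseteq> P" "finite F" "{e..1} \<subseteq> (\<Union>\<alpha>\<in>F. {\<alpha><..<\<alpha> + e})"
    using compactE_image[of "{e..1}" P "\<lambda>\<alpha>. {\<alpha><..<\<alpha> + e}"] by auto
  then show thesis by (intro that[of F]) fastforce+
qed

text \<open>
  A point at height at least \<open>e\<close> is matched through the cut at a selected level just below its
  height; a lower one is matched with its projection to height \<open>0\<close>. As the hypothesis on cuts is
  required only where \<open>w\<close> strictly exceeds the level, the lemma covers both directions of the
  comparison between \<open>u\<close> and \<open>un n\<close>.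
\<close>

lemma endograph_close_if_cuts_close:
  assumes levels: "\<And>t. e \<le> t \<Longrightarrow> t \<le> 1 \<Longrightarrow> \<exists>\<alpha>\<in>F. \<alpha> < t \<and> t < \<alpha> + e"
    and F: "F \<subseteq> {0<..<1}" and e: "0 < e" and v: "\<And>x. 0 \<le> v x"
    and cuts: "\<And>\<alpha> x. \<alpha> \<in> F \<Longrightarrow> \<alpha> < w x \<Longrightarrow> \<exists>y. \<alpha> \<le> v y \<and> dist x y < e"
    and p: "p \<in> endograph w"
  shows "\<exists>q\<in>endograph v. sum_dist p q < 2 * e"
proof -
  obtain x t where xt: "p = (x, t)" "0 \<le> t" "t \<le> 1" "t \<le> w x"
    using p by (auto simp: endograph_def)
  show ?thesis
  proof (cases "t < e")
    case True
    then show ?thesis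
      using v xt e by (intro bexI[of _ "(x, 0)"]) (auto simp: endograph_def sum_dist_def)
  next
    case False
    then obtain \<alpha> where \<alpha>: "\<alpha> \<in> F" "\<alpha> < t" "t < \<alpha> + e" using levels[of t] xt by auto
    then obtain y where "\<alpha> \<le> v y" "dist x y < e" using cuts[of \<alpha> x] xt by auto
    then show ?thesis using \<alpha> F xt
      by (intro bexI[of _ "(y, \<alpha>)"]) (auto simp: endograph_def sum_dist_def)
  qed
qed

lemma H_end_if_cuts_converge:
  fixes u :: "'a::metric_space \<Rightarrow> real"
  assumes u: "u \<in> F1_USC" and un: "\<And>n. n \<ge> 1 \<Longrightarrow> un n \<in> F1_USC"
    and P: "dense_subset P {0<..<1}"
    and lim1: "\<And>\<alpha>. \<alpha> \<in> P \<Longrightarrow>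
      (\<lambda>n. Hausdorff_excess dist (closure {x. u x > \<alpha>}) (alpha_cut (un n) \<alpha>)) \<longlonglongrightarrow> 0"
    and lim2: "\<And>\<alpha>. \<alpha> \<in> P \<Longrightarrow>
      (\<lambda>n. Hausdorff_excess dist (alpha_cut (un n) \<alpha>) (alpha_cut u \<alpha>)) \<longlonglongrightarrow> 0"
  shows "(\<lambda>n. H_end (un n) u) \<longlonglongrightarrow> 0"
proof -
  have close: "\<forall>\<^sub>F n in sequentially.
      (\<forall>p\<in>endograph (un n). \<exists>q\<in>endograph u. sum_dist p q < e) \<and>
      (\<forall>p\<in>endograph u. \<exists>q\<in>endograph (un n). sum_dist p q < e)" if "e > 0" for e
  proof -
    have e: "0 < e/2" using that by simp
    obtain F where F: "finite F" "F \<subseteq> P" "\<And>t. e/2 \<le> t \<Longrightarrow> t \<le> 1 \<Longrightarrow> \<exists>\<alpha>\<in>F. \<alpha> < t \<and> t < \<alpha> + e/2"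
      using finite_levels_just_below[OF P e] by metis
    have F01: "F \<subseteq> {0<..<1}" using F P by (auto simp: dense_subset_def)
    have "\<forall>\<^sub>F n in sequentially. \<forall>\<alpha>\<in>F.
        (\<forall>a\<in>closure {x. u x > \<alpha>}. \<exists>b\<in>alpha_cut (un n) \<alpha>. dist a b < e/2) \<and>
        (\<forall>a\<in>alpha_cut (un n) \<alpha>. \<exists>b\<in>alpha_cut u \<alpha>. dist a b < e/2)"
    proof (rule eventually_ball_finite[OF F(1)], rule ballI, rule eventually_conj)
      fix \<alpha> assume "\<alpha> \<in> F"
      then have "\<alpha> \<in> P" using F by blast
      then show "\<forall>\<^sub>F n in sequentially.
          \<forall>a\<in>closure {x. u x > \<alpha>}. \<exists>b\<in>alpha_cut (un n) \<alpha>. dist a b < e/2"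
        using lim1 e unfolding tendsto_Hausdorff_excess_0_iff by blast
      show "\<forall>\<^sub>F n in sequentially. \<forall>a\<in>alpha_cut (un n) \<alpha>. \<exists>b\<in>alpha_cut u \<alpha>. dist a b < e/2"
        using lim2[OF \<open>\<alpha> \<in> P\<close>] e unfolding tendsto_Hausdorff_excess_0_iff by blast
    qed
    moreover have "\<forall>\<^sub>F n::nat in sequentially. n \<ge> 1" by (rule eventually_ge_at_top)
    ultimately show ?thesis
    proof eventually_elim
      case (elim n)
      have 1: "\<exists>y. \<alpha> \<le> u y \<and> dist x y < e/2" if "\<alpha> \<in> F" "\<alpha> < un n x" for \<alpha> x
      proof -
        have "\<alpha> \<noteq> 0" "x \<in> alpha_cut (un n) \<alpha>" using that F01 by (auto simp: alpha_cut_nonzero)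
        then obtain b where "b \<in> alpha_cut u \<alpha>" "dist x b < e/2"
          using bspec[OF elim(1) \<open>\<alpha> \<in> F\<close>] by meson
        then show ?thesis using \<open>\<alpha> \<noteq> 0\<close> by (auto simp: alpha_cut_nonzero)
      qed
      have 2: "\<exists>y. \<alpha> \<le> un n y \<and> dist x y < e/2" if "\<alpha> \<in> F" "\<alpha> < u x" for \<alpha> x
      proof -
        have "\<alpha> \<noteq> 0" "x \<in> closure {x. \<alpha> < u x}"
          using that F01 closure_subset[of "{x. \<alpha> < u x}"] by auto
        then obtain b where "b \<in> alpha_cut (un n) \<alpha>" "dist x b < e/2"
          using bspec[OF elim(1) \<open>\<alpha> \<in> F\<close>] by meson
        then show ?thesis using \<open>\<alpha> \<noteq> 0\<close> by (auto simp: alpha_cut_nonzero)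
      qed
      have "\<exists>q\<in>endograph u. sum_dist p q < 2 * (e/2)" if "p \<in> endograph (un n)" for p
        using endograph_close_if_cuts_close[OF F(3) F01 e fuzzy_set_bounds(1)[OF u] 1 that] .
      moreover have "\<exists>q\<in>endograph (un n). sum_dist p q < 2 * (e/2)" if "p \<in> endograph u" for p
        using endograph_close_if_cuts_close[OF F(3) F01 e fuzzy_set_bounds(1)[OF un[OF elim(2)]] 2 that] .
      ultimately show ?case by simp
    qed
  qed
  show ?thesis
    unfolding H_end_def tendsto_Hausdorff_distance_0_iff tendsto_Hausdorff_excess_0_iff
    using close by (simp add: eventually_conj_iff)
qed

section \<open>Dense sets of levels\<close>

text \<open>An open subset of \<open>S\<close> that misses the good points is contained in a null set, hence empty.\<close>

lemma AE_imp_dense_subset: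
  assumes S: "open S" and ae: "AE x in lebesgue_on S. Q x"
  shows "dense_subset {x \<in> S. Q x} (S :: real set)"
  unfolding dense_subset_def
proof (intro conjI subsetI)
  fix x assume x: "x \<in> S"
  show "x \<in> closure {x \<in> S. Q x}"
  proof (rule ccontr)
    assume nx: "x \<notin> closure {x \<in> S. Q x}"
    have "AE x in lebesgue. x \<in> S \<longrightarrow> Q x"
      using ae S by (subst (asm) AE_restrict_space_iff) auto
    then obtain N where N: "N \<in> null_sets lebesgue" "{x. \<not> (x \<in> S \<longrightarrow> Q x)} \<subseteq> N"
      by (auto simp: eventually_ae_filter)
    have "S - closure {x \<in> S. Q x} \<subseteq> N" using N(2) closure_subset[of "{x \<in> S. Q x}"] by blast
    then have "negligible (S - closure {x \<in> S. Q x})"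
      using N(1) negligible_subset[of N] by (simp add: negligible_iff_null_sets)
    moreover have "open (S - closure {x \<in> S. Q x})" using S by auto
    ultimately show False using open_not_negligible[of "S - closure {x \<in> S. Q x}"] x nx by blast
  qed
qed auto

lemma AE_not_in_countable:
  assumes "countable C"
  shows "AE x in lebesgue_on {0<..<1::real}. x \<notin> C"
proof -
  have "C \<in> null_sets lebesgue"
    using assms by (intro null_sets_completionI countable_imp_null_set_lborel)
  then have "AE x in lebesgue. x \<notin> C" by (rule AE_not_in)
  then show ?thesis by (subst AE_restrict_space_iff) auto
qed

lemma dense_subset_trans:
  "dense_subset P Q \<Longrightarrow> dense_subset Q S \<Longrightarrow> dense_subset P S"
  unfolding dense_subset_def by (meson closure_minimal closed_closure order_trans)

section \<open>The equivalences\<close>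

theorem theorem5p15:
  fixes u :: "'a::metric_space \<Rightarrow> real" and un :: "nat \<Rightarrow> 'a \<Rightarrow> real"
  assumes "u \<in> F1_USCG" and "\<And>n. n \<ge> 1 \<Longrightarrow> un n \<in> F1_USC"
  shows
    "let
       cond_i = ((\<lambda>n. H_end (un n) u) \<longlonglongrightarrow> 0);
       cond_ii = (\<forall>\<alpha>\<in>{0<..<1}.
         (\<lambda>n. Hausdorff_excess dist (closure {x. u x > \<alpha>}) (alpha_cut (un n) \<alpha>)) \<longlonglongrightarrow> 0 \<and>
         (\<lambda>n. Hausdorff_excess dist (alpha_cut (un n) \<alpha>) (alpha_cut u \<alpha>)) \<longlonglongrightarrow> 0);
       cond_iii = (\<exists>P. dense_subset P {0<..<1} \<and> (\<forall>\<alpha>\<in>P.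
         (\<lambda>n. Hausdorff_excess dist (closure {x. u x > \<alpha>}) (alpha_cut (un n) \<alpha>)) \<longlonglongrightarrow> 0 \<and>
         (\<lambda>n. Hausdorff_excess dist (alpha_cut (un n) \<alpha>) (alpha_cut u \<alpha>)) \<longlonglongrightarrow> 0));
       cond_iv = (\<forall>\<alpha>\<in>{0<..<1} - P0 u.
         (\<lambda>n. Hausdorff_distance dist (alpha_cut u \<alpha>) (alpha_cut (un n) \<alpha>)) \<longlonglongrightarrow> 0);
       cond_v = (\<exists>P. dense_subset P ({0<..<1} - P0 u) \<and> (\<forall>\<alpha>\<in>P.
         (\<lambda>n. Hausdorff_distance dist (alpha_cut u \<alpha>) (alpha_cut (un n) \<alpha>)) \<longlonglongrightarrow> 0));
       cond_vi = (\<exists>P. countable P \<and> dense_subset P ({0<..<1} - P0 u) \<and> (\<forall>\<alpha>\<in>P.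
         (\<lambda>n. Hausdorff_distance dist (alpha_cut u \<alpha>) (alpha_cut (un n) \<alpha>)) \<longlonglongrightarrow> 0));
       cond_vii = (AE \<alpha> in lebesgue_on {0<..<1}.
         (\<lambda>n. Hausdorff_distance dist (alpha_cut (un n) \<alpha>) (alpha_cut u \<alpha>)) \<longlonglongrightarrow> 0)
     in (cond_i \<longleftrightarrow> cond_ii) \<and> (cond_i \<longleftrightarrow> cond_iii) \<and> (cond_i \<longleftrightarrow> cond_iv) \<and>
        (cond_i \<longleftrightarrow> cond_v) \<and> (cond_i \<longleftrightarrow> cond_vi) \<and> (cond_i \<longleftrightarrow> cond_vii)"
proof -
  let ?E1 = "\<lambda>\<alpha> n. Hausdorff_excess dist (closure {x. u x > \<alpha>}) (alpha_cut (un n) \<alpha>)"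
  let ?E2 = "\<lambda>\<alpha> n. Hausdorff_excess dist (alpha_cut (un n) \<alpha>) (alpha_cut u \<alpha>)"
  let ?D = "\<lambda>\<alpha> n. Hausdorff_distance dist (alpha_cut u \<alpha>) (alpha_cut (un n) \<alpha>)"
  let ?I = "{0<..<1::real}"
  define i where "i \<longleftrightarrow> (\<lambda>n. H_end (un n) u) \<longlonglongrightarrow> 0"
  define L where "L \<alpha> \<longleftrightarrow> ?E1 \<alpha> \<longlonglongrightarrow> 0 \<and> ?E2 \<alpha> \<longlonglongrightarrow> 0" for \<alpha>
  define M where "M \<alpha> \<longleftrightarrow> ?D \<alpha> \<longlonglongrightarrow> 0" for \<alpha>
  have M_comm: "((\<lambda>n. Hausdorff_distance dist (alpha_cut (un n) \<alpha>) (alpha_cut u \<alpha>)) \<longlonglongrightarrow> 0) = M \<alpha>" for \<alpha>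
    by (simp add: M_def Hausdorff_distance_commute)
  have u: "u \<in> F1_USC" using assms(1) by (rule F1_USCG_imp_F1_USC)
  have i_L: "L \<alpha>" if i "\<alpha> \<in> ?I" for \<alpha>
    using cuts_converge_if_H_end[OF assms(1)] that by (auto simp: i_def L_def)
  have L_i: i if "dense_subset P ?I" "\<forall>\<alpha>\<in>P. L \<alpha>" for P
    unfolding i_def using that by (intro H_end_if_cuts_converge[OF u assms(2) that(1)]) (auto simp: L_def)
  have M_iff_L: "M \<alpha> \<longleftrightarrow> L \<alpha>" if "\<alpha> \<in> ?I - P0 u" for \<alpha>
    unfolding M_def L_def tendsto_Hausdorff_distance_0_iff
    by (simp add: cut_eq_closure_if_not_P0[OF assms(1) that])
  \<comment> \<open>This direction holds at discontinuity levels too, as the closure of \<open>{u > \<alpha>}\<close> always lies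
      in the cut; so it applies to every level that an almost-everywhere statement provides.\<close>
  have M_L: "L \<alpha>" if "M \<alpha>" "\<alpha> \<in> ?I" for \<alpha>
  proof -
    have sub: "closure {x. \<alpha> < u x} \<subseteq> alpha_cut u \<alpha>"
      using closure_strict_cut_subset[OF assms(1)] that(2) by (simp add: alpha_cut_nonzero)
    have "?E1 \<alpha> \<longlonglongrightarrow> 0"
    proof (rule tendsto_sandwich[OF _ _ tendsto_const])
      show "(\<lambda>n. Hausdorff_excess dist (alpha_cut u \<alpha>) (alpha_cut (un n) \<alpha>)) \<longlonglongrightarrow> 0"
        using that(1) by (simp add: M_def tendsto_Hausdorff_distance_0_iff)
    qed (simp_all add: Hausdorff_excess_mono_left[OF sub])
    then show ?thesis
      using that(1) by (simp add: M_def L_def tendsto_Hausdorff_distance_0_iff)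
  qed
  have ae_P0: "AE \<alpha> in lebesgue_on ?I. \<alpha> \<notin> P0 u"
    using AE_not_in_countable countable_P0[OF assms(1)] .
  have dense_cont: "dense_subset (?I - P0 u) ?I"
    using AE_imp_dense_subset[OF _ ae_P0] by (simp add: set_diff_eq)
  have ii: "i \<longleftrightarrow> (\<forall>\<alpha>\<in>?I. L \<alpha>)"
    using i_L L_i[of ?I] closure_subset[of ?I] unfolding dense_subset_def by blast
  have iii: "i \<longleftrightarrow> (\<exists>P. dense_subset P ?I \<and> (\<forall>\<alpha>\<in>P. L \<alpha>))"
    using i_L L_i closure_subset[of ?I] by (auto simp: dense_subset_def)
  have v_i: i if P: "dense_subset P (?I - P0 u)" "\<forall>\<alpha>\<in>P. M \<alpha>" for P
  proof (rule L_i)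
    show "dense_subset P ?I" using P(1) dense_cont by (rule dense_subset_trans)
    show "\<forall>\<alpha>\<in>P. L \<alpha>" using P M_iff_L unfolding dense_subset_def by blast
  qed
  have i_iv: "\<forall>\<alpha>\<in>?I - P0 u. M \<alpha>" if i using i_L[OF that] M_iff_L by blast
  have refl: "dense_subset (?I - P0 u) (?I - P0 u)" by (simp add: dense_subset_def closure_subset)
  have iv: "i \<longleftrightarrow> (\<forall>\<alpha>\<in>?I - P0 u. M \<alpha>)" using i_iv v_i refl by blast
  have v: "i \<longleftrightarrow> (\<exists>P. dense_subset P (?I - P0 u) \<and> (\<forall>\<alpha>\<in>P. M \<alpha>))"
    using i_iv v_i refl by blast
  obtain C where C: "countable C" "dense_subset C (?I - P0 u)"
    unfolding dense_subset_def using separable[of "?I - P0 u"] by metis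
  have vi: "i \<longleftrightarrow> (\<exists>P. countable P \<and> dense_subset P (?I - P0 u) \<and> (\<forall>\<alpha>\<in>P. M \<alpha>))"
  proof
    assume i
    have "\<forall>\<alpha>\<in>C. M \<alpha>" using i_iv[OF \<open>i\<close>] C(2) unfolding dense_subset_def by (meson subsetD)
    with C show "\<exists>P. countable P \<and> dense_subset P (?I - P0 u) \<and> (\<forall>\<alpha>\<in>P. M \<alpha>)" by blast
  qed (use v_i in blast)
  have vii: "i \<longleftrightarrow> (AE \<alpha> in lebesgue_on ?I. M \<alpha>)"
  proof
    assume i
    show "AE \<alpha> in lebesgue_on ?I. M \<alpha>"
      using ae_P0 AE_space
    proof eventually_elim
      case (elim \<alpha>)
      then show ?case using i_iv[OF \<open>i\<close>] by (simp add: space_restrict_space)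
    qed
  next
    assume "AE \<alpha> in lebesgue_on ?I. M \<alpha>"
    then have "dense_subset {\<alpha> \<in> ?I. M \<alpha>} ?I" by (intro AE_imp_dense_subset) auto
    then show i by (rule L_i) (use M_L in blast)
  qed
  show ?thesis
    unfolding Let_def M_comm
    unfolding i_def[symmetric] L_def[symmetric] M_def[symmetric]
    using ii iii iv v vi vii by blast
qed

end
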